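(* For each $n \in \{52, 54, 57, 60\}$ there exists a 4-regular matchstick graph with exactly $n$ vertices.
   Context: A matchstick graph is a finite graph drawn in the Euclidean plane such that vertices are distinct points, every edge is a straight line segment of length 1 between its endpoints, and edges do not cross or overlap (two edges intersect at most in a common endpoint). A matchstick graph is 4-regular if every vertex has degree exactly 4. *)

theory Defs
  imports "HOL-Analysis.Analysis"
begin

definition matchstick_graph :: "complex set \<Rightarrow> complex set set \<Rightarrow> bool" where
  "matchstick_graph V E \<longleftrightarrow>
     finite V \<and>
     (\<forall>e\<in>E. \<exists>u v. e = {u, v} \<and> u \<in> V \<and> v \<in> V \<and> u \<noteq> v \<and> dist u v = 1) \<and>
     (\<forall>u v u' v'. {u, v} \<in> E \<and> {u', v'} \<in> E \<and> {u, v} \<noteq> {u', v'} \<longrightarrow>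
        closed_segment u v \<inter> closed_segment u' v' \<subseteq> {u, v} \<inter> {u', v'})"

definition degree :: "complex set set \<Rightarrow> complex \<Rightarrow> nat" where
  "degree E v = card {e \<in> E. v \<in> e}"

definition four_regular_matchstick_graph :: "complex set \<Rightarrow> complex set set \<Rightarrow> bool" where
  "four_regular_matchstick_graph V E \<longleftrightarrow>
     matchstick_graph V E \<and> (\<forall>v\<in>V. degree E v = 4)"

end

(*
  In each of the four graphs any two edges are either separated by a line or share an endpoint, with a
  margin that survives rounding of all coordinates to multiples of 1/200; so planarity and degrees are
  decided by integer arithmetic, and only the existence of coordinates with exact unit lengths is left.

  The graphs with 57 and 60 vertices have coordinates in Q(sqrt 3, sqrt 5). The graph with 52 vertices
  (Harborth's graph) and the one with 54 are symmetric in both coordinate axes. A quarter of such a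
  graph has as many unknown coordinates as edges, and its Jacobian is well conditioned, so Brouwer's
  theorem applied to a simplified Newton map gives an exact solution near a numerical one.
*)

theory Submission
  imports Defs
begin

subsection \<open>Rounded drawings\<close>

text \<open>Edges with a common endpoint cannot be separated by any margin, however fine the grid.
  Their equal lengths settle them: two unit segments from one point meet again only if they
  coincide, so it is enough that their other endpoints differ. With the usual map
  \<open>x - A f(x)\<close> a fixed point yields only \<open>A f(x) = 0\<close>; in the variable
  \<open>y\<close> with \<open>x = X + A y\<close>, a fixed point of \<open>y - f(X + A y)\<close>
  gives \<open>f = 0\<close> at once. Brouwer asks for a cube mapped into itself, not for a
  contraction constant, and since \<open>f\<close> is quadratic its expansion at \<open>X\<close> is
  exact: three terms remain, each bounded by integers. The tolerance of one grid unit is shared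
  between rounding to the grid, at most 1/2, and the distance from the exact point to its computed
  approximation, at most 0.42 for the Newton solutions and 1/2 for the rounded square roots.\<close>

lemma closed_segments_disjoint:
  fixes n u v u' v' :: "'a::real_inner"
  assumes "\<And>p q. p \<in> {u, v} \<Longrightarrow> q \<in> {u', v'} \<Longrightarrow> n \<bullet> p < n \<bullet> q"
  shows "closed_segment u v \<inter> closed_segment u' v' = {}"
proof -
  have "closed_segment u v \<subseteq> {x. n \<bullet> x \<le> max (n \<bullet> u) (n \<bullet> v)}"
    by (rule closed_segment_subset) (auto intro: convex_halfspace_le)
  moreover have "closed_segment u' v' \<subseteq> {x. n \<bullet> x \<ge> min (n \<bullet> u') (n \<bullet> v')}"
    by (rule closed_segment_subset) (auto intro: convex_halfspace_ge)
  moreover have "max (n \<bullet> u) (n \<bullet> v) < min (n \<bullet> u') (n \<bullet> v')"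
    using assms by simp
  ultimately show ?thesis
    by fastforce
qed

text \<open>On a unit segment starting at \<open>u\<close> the parameter of a point is its distance
  from \<open>u\<close>. A common point therefore has the same parameter \<open>s\<close> on both
  segments, and \<open>s\<close> times \<open>v - w\<close> vanishes.\<close>

lemma unit_segments_common_endpoint:
  fixes u v w :: "'a::real_normed_vector"
  assumes "dist u v = 1" "dist u w = 1" "v \<noteq> w"
  shows "closed_segment u v \<inter> closed_segment u w \<subseteq> {u}"
proof
  fix z assume "z \<in> closed_segment u v \<inter> closed_segment u w"
  then obtain s t where st: "0 \<le> s" "0 \<le> t"
    and z: "z = (1 - s) *\<^sub>R u + s *\<^sub>R v" "z = (1 - t) *\<^sub>R u + t *\<^sub>R w"
    by (auto simp: in_segment)
  have eqs: "z - u = s *\<^sub>R (v - u)" "z - u = t *\<^sub>R (w - u)"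
    by (subst z(1), simp add: algebra_simps) (subst z(2), simp add: algebra_simps)
  have "norm (v - u) = 1" "norm (w - u) = 1"
    using assms by (simp_all add: dist_norm norm_minus_commute)
  then have "norm (z - u) = s" "norm (z - u) = t"
    using st by (simp add: eqs(1), simp add: eqs(2))
  then have "s = t"
    by simp
  have "s *\<^sub>R (v - w) = s *\<^sub>R (v - u) - s *\<^sub>R (w - u)"
    by (simp add: algebra_simps)
  then have "s *\<^sub>R (v - w) = 0"
    using eqs \<open>s = t\<close> by (metis diff_self)
  then show "z \<in> {u}"
    using assms eqs by auto
qed

section \<open>Integer tests on rounded drawings\<close>

type_synonym grid_point = "int \<times> int"

text \<open>Grid points are approximations in units of 1/200, correct to within one unit.\<close>

definition near_grid :: "complex \<Rightarrow> grid_point \<Rightarrow> bool" where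
  "near_grid z g \<longleftrightarrow> \<bar>200 * Re z - of_int (fst g)\<bar> \<le> 1 \<and> \<bar>200 * Im z - of_int (snd g)\<bar> \<le> 1"

text \<open>The slack \<open>2 * (\<bar>a\<bar> + \<bar>b\<bar>)\<close> absorbs the rounding of both segments.\<close>

definition separated_along ::
  "int \<Rightarrow> int \<Rightarrow> grid_point \<times> grid_point \<Rightarrow> grid_point \<times> grid_point \<Rightarrow> bool" where
  "separated_along a b e f = (case e of ((x1, y1), (x2, y2)) \<Rightarrow> case f of ((x3, y3), (x4, y4)) \<Rightarrow>
     if max (a * x1 + b * y1) (a * x2 + b * y2) + 2 * (\<bar>a\<bar> + \<bar>b\<bar>)
          < min (a * x3 + b * y3) (a * x4 + b * y4) then True
     else max (a * x3 + b * y3) (a * x4 + b * y4) + 2 * (\<bar>a\<bar> + \<bar>b\<bar>)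
          < min (a * x1 + b * y1) (a * x2 + b * y2))"

text \<open>The coefficients form a normal vector of the rounded \<open>e\<close>. Disjoint segments
  that do not lie on one line have a separating line parallel to one of them, so the normals of both
  edges are the directions worth trying.\<close>

definition separated_by_normal :: "grid_point \<times> grid_point \<Rightarrow> grid_point \<times> grid_point \<Rightarrow> bool" where
  "separated_by_normal e f =
     (case e of ((x1, y1), (x2, y2)) \<Rightarrow> separated_along (y1 - y2) (x2 - x1) e f)"

text \<open>Nested conditionals, because \<open>code_simp\<close> evaluates both sides of a disjunction.\<close>

definition compatible :: "grid_point \<times> grid_point \<Rightarrow> grid_point \<times> grid_point \<Rightarrow> bool" where
  "compatible e f =
    (if separated_along 1 0 e f then True else if separated_along 0 1 e f then True
     else if fst e = fst f then snd e \<noteq> snd f else if fst e = snd f then snd e \<noteq> fst f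
     else if snd e = fst f then True else if snd e = snd f then True
     else if separated_by_normal e f then True else separated_by_normal f e)"

text \<open>Two grid points near the same complex number differ by at most 2 in each
  coordinate.\<close>

definition far_apart :: "grid_point \<Rightarrow> grid_point \<Rightarrow> bool" where
  "far_apart g h = (if \<bar>fst g - fst h\<bar> > 2 then True else \<bar>snd g - snd h\<bar> > 2)"

definition endpoints :: "('a \<times> 'a) list \<Rightarrow> 'a list" where
  "endpoints es = remdups (map fst es @ map snd es)"

definition four_regular_on :: "'a list \<Rightarrow> ('a \<times> 'a) list \<Rightarrow> bool" where
  "four_regular_on vs es =
     list_all (\<lambda>v. length (filter (\<lambda>e. fst e = v \<or> snd e = v) es) = 4) vs"

text \<open>\<open>sorted_wrt\<close> visits each pair of list entries once. The vertex list is an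
  argument so that it can be evaluated once and used three times.\<close>

definition drawing_check :: "nat \<Rightarrow> (grid_point \<times> grid_point) list \<Rightarrow> grid_point list \<Rightarrow> bool" where
  "drawing_check n es vs \<longleftrightarrow> length vs = n \<and> sorted_wrt far_apart vs \<and> four_regular_on vs es \<and>
     sorted_wrt compatible es"

section \<open>Soundness of the integer tests\<close>

lemma near_grid_functional:
  assumes "near_grid z g"
  shows "200 * (Complex (of_int a) (of_int b) \<bullet> z) \<le> of_int (a * fst g + b * snd g + (\<bar>a\<bar> + \<bar>b\<bar>))"
    and "200 * (Complex (of_int a) (of_int b) \<bullet> z) \<ge> of_int (a * fst g + b * snd g - (\<bar>a\<bar> + \<bar>b\<bar>))"
proof -
  have *: "\<bar>of_int a * (200 * Re z - of_int (fst g))\<bar> \<le> \<bar>of_int a\<bar> * 1"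
    "\<bar>of_int b * (200 * Im z - of_int (snd g))\<bar> \<le> \<bar>of_int b\<bar> * 1"
    using assms unfolding near_grid_def abs_mult by (auto intro!: mult_left_le)
  then show "200 * (Complex (of_int a) (of_int b) \<bullet> z) \<le> of_int (a * fst g + b * snd g + (\<bar>a\<bar> + \<bar>b\<bar>))"
    "200 * (Complex (of_int a) (of_int b) \<bullet> z) \<ge> of_int (a * fst g + b * snd g - (\<bar>a\<bar> + \<bar>b\<bar>))"
    by (auto simp: inner_complex_def algebra_simps)
qed

text \<open>Rounding changes the functional by at most \<open>\<bar>a\<bar> + \<bar>b\<bar>\<close>
  at each of the two points; together this is the slack in \<open>separated_along\<close>.\<close>

lemma near_grid_less:
  assumes "near_grid z g" "near_grid w h"
    and "a * fst g + b * snd g + 2 * (\<bar>a\<bar> + \<bar>b\<bar>) < a * fst h + b * snd h"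
  shows "Complex (of_int a) (of_int b) \<bullet> z < Complex (of_int a) (of_int b) \<bullet> w"
proof -
  have "(of_int (a * fst g + b * snd g + (\<bar>a\<bar> + \<bar>b\<bar>)) :: real) <
      of_int (a * fst h + b * snd h - (\<bar>a\<bar> + \<bar>b\<bar>))"
    using assms(3) by (subst of_int_less_iff) simp
  then show ?thesis
    using near_grid_functional(1)[OF assms(1), of a b] near_grid_functional(2)[OF assms(2), of a b]
    by linarith
qed

lemma separated_along_disjoint:
  assumes "separated_along a b (g1, g2) (g3, g4)"
    and "near_grid z1 g1" "near_grid z2 g2" "near_grid z3 g3" "near_grid z4 g4"
  shows "closed_segment z1 z2 \<inter> closed_segment z3 z4 = {}"
proof -
  let ?n = "Complex (of_int a) (of_int b)" and ?L = "\<lambda>g. a * fst g + b * snd g"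
    and ?m = "2 * (\<bar>a\<bar> + \<bar>b\<bar>)"
  consider "max (?L g1) (?L g2) + ?m < min (?L g3) (?L g4)" | "max (?L g3) (?L g4) + ?m < min (?L g1) (?L g2)"
    using assms(1) unfolding separated_along_def split_beta fst_conv snd_conv by presburger
  then have "(\<forall>p\<in>{z1, z2}. \<forall>q\<in>{z3, z4}. ?n \<bullet> p < ?n \<bullet> q) \<or> (\<forall>p\<in>{z3, z4}. \<forall>q\<in>{z1, z2}. ?n \<bullet> p < ?n \<bullet> q)"
  proof cases
    case 1
    then have "?L g1 + ?m < ?L g3" "?L g1 + ?m < ?L g4" "?L g2 + ?m < ?L g3" "?L g2 + ?m < ?L g4"
      by linarith+
    then show ?thesis
      using assms(2-5) near_grid_less by blast
  next
    case 2
    then have "?L g3 + ?m < ?L g1" "?L g3 + ?m < ?L g2" "?L g4 + ?m < ?L g1" "?L g4 + ?m < ?L g2"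
      by linarith+
    then show ?thesis
      using assms(2-5) near_grid_less by blast
  qed
  then show ?thesis
    using closed_segments_disjoint[of z1 z2 z3 z4 ?n] closed_segments_disjoint[of z3 z4 z1 z2 ?n]
    by blast
qed

lemma sorted_wrt_cases:
  assumes "sorted_wrt R xs" "x \<in> set xs" "y \<in> set xs" "x \<noteq> y"
  shows "R x y \<or> R y x"
  using assms by (induction xs) auto

lemma near_grid_far_apart:
  assumes "near_grid z g" "near_grid w h" "far_apart g h"
  shows "z \<noteq> w"
proof
  assume zw: "z = w"
  have "\<bar>fst g - fst h\<bar> \<le> 2"
    using assms(1,2) unfolding near_grid_def zw by (elim conjE) linarith
  moreover have "\<bar>snd g - snd h\<bar> \<le> 2"
    using assms(1,2) unfolding near_grid_def zw by (elim conjE) linarith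
  ultimately show False
    using assms(3) unfolding far_apart_def by (auto split: if_splits)
qed

text \<open>Besides planarity, the distinctness of the two edges as sets is recorded: it lets the
  degrees be counted in the edge list.\<close>

lemma compatible_segments:
  assumes comp: "compatible (g1, g2) (g3, g4)"
    and near: "\<And>g. g \<in> {g1, g2, g3, g4} \<Longrightarrow> near_grid (Q g) g"
    and inj: "inj_on Q {g1, g2, g3, g4}"
    and dist: "dist (Q g1) (Q g2) = 1" "dist (Q g3) (Q g4) = 1"
  shows "{Q g1, Q g2} \<noteq> {Q g3, Q g4}"
    and "closed_segment (Q g1) (Q g2) \<inter> closed_segment (Q g3) (Q g4) \<subseteq> {Q g1, Q g2} \<inter> {Q g3, Q g4}"
proof -
  have Q_eq: "Q g = Q h \<longleftrightarrow> g = h" if "g \<in> {g1, g2, g3, g4}" "h \<in> {g1, g2, g3, g4}" for g h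
    using inj that by (meson inj_on_def)
  have ne: "g1 \<noteq> g2" "g3 \<noteq> g4"
    using dist by auto
  \<comment> \<open>The inequalities in the last two cases come from conditionals that failed
    before: \<open>snd e = fst f\<close> is tested only after \<open>fst e = snd f\<close>, and
    \<open>snd e = snd f\<close> only after \<open>fst e = fst f\<close>.\<close>
  consider (sep) a b where "separated_along a b (g1, g2) (g3, g4) \<or> separated_along a b (g3, g4) (g1, g2)"
    | (ff) "g1 = g3" "g2 \<noteq> g4" | (fs) "g1 = g4" "g2 \<noteq> g3"
    | (sf) "g2 = g3" "g1 \<noteq> g4" | (ss) "g2 = g4" "g1 \<noteq> g3"
    using comp unfolding compatible_def separated_by_normal_def
    by (auto simp: split_beta split: if_splits)
  note cases = this
  have disj: "closed_segment (Q g1) (Q g2) \<inter> closed_segment (Q g3) (Q g4) = {}"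
    if "separated_along a b (g1, g2) (g3, g4) \<or> separated_along a b (g3, g4) (g1, g2)" for a b
    using that separated_along_disjoint[of a b g1 g2 g3 g4 "Q g1" "Q g2" "Q g3" "Q g4"]
      separated_along_disjoint[of a b g3 g4 g1 g2 "Q g3" "Q g4" "Q g1" "Q g2"] near by auto
  from cases show "{Q g1, Q g2} \<noteq> {Q g3, Q g4}"
  proof cases
    case (sep a b)
    show ?thesis
      using disj[OF sep] ends_in_segment[of "Q g1" "Q g2"] ends_in_segment[of "Q g3" "Q g4"]
      by (metis IntI doubleton_eq_iff empty_iff)
  qed (use ne in \<open>auto simp: doubleton_eq_iff Q_eq\<close>)
  from cases show "closed_segment (Q g1) (Q g2) \<inter> closed_segment (Q g3) (Q g4) \<subseteq> {Q g1, Q g2} \<inter> {Q g3, Q g4}"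
  proof cases
    case (sep a b)
    then show ?thesis using disj by blast
  next
    case ff
    then show ?thesis
      using unit_segments_common_endpoint[of "Q g1" "Q g2" "Q g4"] dist Q_eq[of g2 g4] by auto
  next
    case fs
    then show ?thesis
      using unit_segments_common_endpoint[of "Q g1" "Q g2" "Q g3"] dist Q_eq[of g2 g3]
      by (auto simp: dist_commute closed_segment_commute)
  next
    case sf
    then show ?thesis
      using unit_segments_common_endpoint[of "Q g2" "Q g1" "Q g4"] dist Q_eq[of g1 g4]
      by (auto simp: dist_commute closed_segment_commute)
  next
    case ss
    then show ?thesis
      using unit_segments_common_endpoint[of "Q g2" "Q g1" "Q g3"] dist Q_eq[of g1 g3]
      by (auto simp: dist_commute closed_segment_commute)
  qed
qed

text \<open>The rounded points serve as names of the exact vertices \<open>Q g\<close>. The test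
  \<open>far_apart\<close> makes \<open>Q\<close> injective, so incidences, and hence degrees, agree
  with those of the names.\<close>

lemma four_regular_of_drawing:
  fixes Q :: "grid_point \<Rightarrow> complex"
  assumes check: "drawing_check n es (endpoints es)"
    and near: "\<And>g. g \<in> set (endpoints es) \<Longrightarrow> near_grid (Q g) g"
    and unit: "\<And>g h. (g, h) \<in> set es \<Longrightarrow> dist (Q g) (Q h) = 1"
  shows "\<exists>V E. four_regular_matchstick_graph V E \<and> card V = n"
proof (intro exI conjI)
  define vs where "vs = endpoints es"
  define F where "F = (\<lambda>(g, h). {Q g, Q h})"
  let ?V = "Q ` set vs" and ?E = "F ` set es"
  have chk: "length vs = n" "sorted_wrt far_apart vs" "four_regular_on vs es" "sorted_wrt compatible es"
    using check by (auto simp: drawing_check_def vs_def)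
  have vs: "distinct vs" "set vs = fst ` set es \<union> snd ` set es"
    by (auto simp: vs_def endpoints_def)
  have inV: "g \<in> set vs" "h \<in> set vs" if "(g, h) \<in> set es" for g h
    using that vs(2) by force+
  have inj: "inj_on Q (set vs)"
  proof (rule inj_onI, rule ccontr)
    fix g h assume gh: "g \<in> set vs" "h \<in> set vs" "Q g = Q h" "g \<noteq> h"
    then have "far_apart g h \<or> far_apart h g"
      using sorted_wrt_cases[OF chk(2)] by blast
    then show False
      using near_grid_far_apart near gh(1-3) unfolding vs_def by metis
  qed
  have Q_eq: "Q g = Q h \<longleftrightarrow> g = h" if "g \<in> set vs" "h \<in> set vs" for g h
    using inj that by (meson inj_on_def)
  show "card ?V = n"
    using chk(1) vs(1) by (simp add: card_image[OF inj] distinct_card)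
  have comp: "F e \<noteq> F f"
    "closed_segment (Q (fst e)) (Q (snd e)) \<inter> closed_segment (Q (fst f)) (Q (snd f)) \<subseteq> F e \<inter> F f"
    if "compatible e f" "e \<in> set es" "f \<in> set es" for e f
  proof -
    obtain g1 g2 g3 g4 where ef: "e = (g1, g2)" "f = (g3, g4)"
      by (cases e, cases f)
    have sub: "{g1, g2, g3, g4} \<subseteq> set vs"
      using inV that ef by auto
    have near': "near_grid (Q g) g" if "g \<in> {g1, g2, g3, g4}" for g
      using near sub that unfolding vs_def by blast
    have "dist (Q g1) (Q g2) = 1" "dist (Q g3) (Q g4) = 1"
      using unit that(2,3) ef by auto
    note * = compatible_segments[OF that(1)[unfolded ef] near' inj_on_subset[OF inj sub] this]
    show "F e \<noteq> F f"
      "closed_segment (Q (fst e)) (Q (snd e)) \<inter> closed_segment (Q (fst f)) (Q (snd f)) \<subseteq> F e \<inter> F f"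
      using * unfolding ef F_def by simp_all
  qed
  have injF: "inj_on F (set es)"
    using sorted_wrt_cases[OF chk(4)] comp(1) by (metis inj_onI)
  \<comment> \<open>A repeated edge would be compatible with itself and give
    \<open>F e \<noteq> F e\<close>.\<close>
  have dist_es: "distinct es"
    unfolding distinct_conv_nth
    using chk(4) comp(1) by (metis linorder_neqE_nat nth_mem sorted_wrt_nth_less)
  show "four_regular_matchstick_graph ?V ?E"
    unfolding four_regular_matchstick_graph_def matchstick_graph_def
  proof (intro conjI ballI allI impI)
    show "finite ?V" by simp
  next
    fix e assume "e \<in> ?E"
    then obtain g h where "(g, h) \<in> set es" "e = {Q g, Q h}"
      by (auto simp: F_def)
    then show "\<exists>u v. e = {u, v} \<and> u \<in> ?V \<and> v \<in> ?V \<and> u \<noteq> v \<and> dist u v = 1"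
      using inV[of g h] unit[of g h] by (metis dist_self imageI zero_neq_one)
  next
    fix u v u' v' assume *: "{u, v} \<in> ?E \<and> {u', v'} \<in> ?E \<and> {u, v} \<noteq> {u', v'}"
    then obtain e f where ef: "e \<in> set es" "f \<in> set es" "{u, v} = F e" "{u', v'} = F f"
      by blast
    then have "e \<noteq> f"
      using * by auto
    have seg: "closed_segment a b = closed_segment (Q (fst x)) (Q (snd x))" if "{a, b} = F x" for a b x
      using that by (auto simp: F_def split_beta doubleton_eq_iff closed_segment_commute)
    have "compatible e f \<or> compatible f e"
      using sorted_wrt_cases[OF chk(4)] ef \<open>e \<noteq> f\<close> by blast
    then show "closed_segment u v \<inter> closed_segment u' v' \<subseteq> {u, v} \<inter> {u', v'}"
      using comp(2)[of e f] comp(2)[of f e] ef(1,2)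
      unfolding seg[OF ef(3)] seg[OF ef(4)] ef(3,4) by blast
  next
    fix v assume "v \<in> ?V"
    then obtain g where g: "g \<in> set vs" "v = Q g" by auto
    have "v \<in> F e \<longleftrightarrow> fst e = g \<or> snd e = g" if "e \<in> set es" for e
      using that inV[of "fst e" "snd e"] Q_eq g by (auto simp: F_def split_beta)
    then have "{e \<in> ?E. v \<in> e} = F ` {e \<in> set es. fst e = g \<or> snd e = g}"
      by auto
    then have "degree ?E v = card {e \<in> set es. fst e = g \<or> snd e = g}"
      unfolding degree_def
      by (simp add: card_image[OF inj_on_subset[OF injF]])
    also have "\<dots> = length (filter (\<lambda>e. fst e = g \<or> snd e = g) es)"
      using distinct_card[OF distinct_filter[OF dist_es]] by simp
    also have "\<dots> = 4"
      using chk(3) g(1) by (simp add: four_regular_on_def list_all_iff)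
    finally show "degree ?E v = 4" .
  qed
qed

text \<open>Exact points are described by codes that carry more than their rounding. There are
  \<open>n\<close> codes and also \<open>n\<close> rounded points, so rounding is injective on codes
  and can be inverted to reach \<open>four_regular_of_drawing\<close>.\<close>

lemma four_regular_of_coded_drawing:
  fixes P :: "'k \<Rightarrow> complex" and ap :: "'k \<Rightarrow> grid_point" and es :: "('k \<times> 'k) list"
  assumes "length (endpoints es) = n"
    and check: "drawing_check n (map (map_prod ap ap) es) (endpoints (map (map_prod ap ap) es))"
    and near: "\<And>k. k \<in> set (endpoints es) \<Longrightarrow> near_grid (P k) (ap k)"
    and unit: "\<And>k l. (k, l) \<in> set es \<Longrightarrow> dist (P k) (P l) = 1"
  shows "\<exists>V E. four_regular_matchstick_graph V E \<and> card V = n"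
proof -
  let ?K = "set (endpoints es)" and ?G = "map (map_prod ap ap) es"
  have sets: "?K = fst ` set es \<union> snd ` set es"
    "set (endpoints ?G) = ap ` ?K"
    by (simp_all add: endpoints_def image_Un image_image)
  have "card (set (endpoints ?G)) = n" "card ?K = n"
    using assms(1) check by (simp_all add: drawing_check_def endpoints_def length_remdups_card_conv)
  then have inj: "inj_on ap ?K"
    using sets by (intro eq_card_imp_inj_on) auto
  define Q where "Q = P \<circ> inv_into ?K ap"
  have Q: "Q (ap k) = P k" if "k \<in> ?K" for k
    using inj that by (simp add: Q_def)
  show ?thesis
  proof (rule four_regular_of_drawing[OF check])
    show "near_grid (Q g) g" if "g \<in> set (endpoints ?G)" for g
      using that near Q unfolding sets(2) by auto
    show "dist (Q g) (Q h) = 1" if gh: "(g, h) \<in> set ?G" for g h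
    proof -
      obtain k l where kl: "(k, l) \<in> set es" "g = ap k" "h = ap l"
        using gh by auto
      then have "k \<in> ?K" "l \<in> ?K"
        unfolding sets(1) by force+
      then show ?thesis
        using kl unit Q by simp
    qed
  qed
qed

subsection \<open>Exact solutions near approximate ones\<close>

text \<open>The type \<open>'a\<close> supplies the dimension; a numbering \<open>b\<close> of its
  basis turns the cube of radius \<open>r\<close> in \<open>'a\<close> into bounds on coordinates
  indexed by numbers. Continuity is asked for every \<open>b\<close> because the numbering is chosen
  inside the proof.\<close>

lemma brouwer_coordinates:
  fixes g :: "nat \<Rightarrow> (nat \<Rightarrow> real) \<Rightarrow> real"
  assumes dim: "DIM('a::euclidean_space) = m"
    and cont: "\<And>i (b :: nat \<Rightarrow> 'a). i < m \<Longrightarrow> continuous_on UNIV (\<lambda>x. g i (\<lambda>j. x \<bullet> b j))"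
    and maps: "\<And>i y. i < m \<Longrightarrow> (\<And>j. j < m \<Longrightarrow> \<bar>y j\<bar> \<le> r) \<Longrightarrow> \<bar>g i y\<bar> \<le> r"
    and "0 \<le> r"
  shows "\<exists>y. (\<forall>i<m. \<bar>y i\<bar> \<le> r \<and> g i y = y i)"
proof -
  obtain b :: "nat \<Rightarrow> 'a" where b: "bij_betw b {0..<m} Basis"
    using ex_bij_betw_nat_finite[OF finite_Basis] dim by metis
  define G where "G x = (\<Sum>i\<in>{0..<m}. g i (\<lambda>j. x \<bullet> b j) *\<^sub>R b i)" for x
  define S where "S = cbox (- r *\<^sub>R One) (r *\<^sub>R (One :: 'a))"
  have Basis_b: "Basis = b ` {0..<m}"
    using b by (simp add: bij_betw_def)
  have G_coord: "G x \<bullet> b i = g i (\<lambda>j. x \<bullet> b j)" if "i < m" for x i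
  proof -
    have "G x \<bullet> b i = (\<Sum>k\<in>{0..<m}. g k (\<lambda>j. x \<bullet> b j) * (if k = i then 1 else 0))"
      unfolding G_def inner_sum_left inner_scaleR_left
    proof (rule sum.cong)
      fix k assume "k \<in> {0..<m}"
      then have "b k \<in> Basis" "b i \<in> Basis" "b k = b i \<longleftrightarrow> k = i"
        using that b unfolding Basis_b bij_betw_def by (auto dest: inj_onD)
      then have "b k \<bullet> b i = (if k = i then 1 else 0)"
        by (simp add: inner_Basis)
      then show "g k (\<lambda>j. x \<bullet> b j) * (b k \<bullet> b i) = g k (\<lambda>j. x \<bullet> b j) * (if k = i then 1 else 0)"
        by simp
    qed simp
    then show ?thesis
      using that by (simp add: if_distrib[of "\<lambda>c. _ * c"] cong: if_cong)
  qed
  have S_iff: "x \<in> S \<longleftrightarrow> (\<forall>i<m. \<bar>x \<bullet> b i\<bar> \<le> r)" for x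
  proof -
    have "x \<in> S \<longleftrightarrow> (\<forall>e\<in>Basis. \<bar>x \<bullet> e\<bar> \<le> r)"
      unfolding S_def mem_box by (intro ball_cong refl) (simp add: abs_le_iff, linarith)
    then show ?thesis
      unfolding Basis_b by auto
  qed
  have "compact S" "convex S"
    by (simp_all add: S_def convex_box)
  moreover have "S \<noteq> {}"
    using S_iff[of 0] \<open>0 \<le> r\<close> by auto
  moreover have "continuous_on S G"
    unfolding G_def
    by (intro continuous_on_sum continuous_on_scaleR continuous_on_const
        continuous_on_subset[OF cont]) auto
  moreover have "G \<in> S \<rightarrow> S"
  proof
    fix x assume "x \<in> S"
    then show "G x \<in> S"
      using maps[of _ "\<lambda>j. x \<bullet> b j"] G_coord[of _ x] S_iff[of x] S_iff[of "G x"] by simp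
  qed
  ultimately obtain x where "x \<in> S" "G x = x"
    by (rule brouwer)
  then have "\<forall>i<m. \<bar>x \<bullet> b i\<bar> \<le> r \<and> g i (\<lambda>j. x \<bullet> b j) = x \<bullet> b i"
    using S_iff[of x] G_coord[of _ x] by simp
  then show ?thesis
    by (intro exI[of _ "\<lambda>j. x \<bullet> b j"])
qed

section \<open>Integer certificate for the Newton map\<close>

definition norm1 :: "int list \<Rightarrow> int" where
  "norm1 zs = sum_list (map abs zs)"

definition dot :: "int list \<Rightarrow> (nat \<Rightarrow> real) \<Rightarrow> real" where
  "dot zs y = (\<Sum>j<length zs. of_int (zs ! j) * y j)"

lemma abs_dot_le:
  assumes "\<And>j. j < length zs \<Longrightarrow> \<bar>y j\<bar> \<le> r"
  shows "\<bar>dot zs y\<bar> \<le> of_int (norm1 zs) * r"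
proof -
  have "\<bar>dot zs y\<bar> \<le> (\<Sum>j<length zs. \<bar>of_int (zs ! j)\<bar> * r)"
    unfolding dot_def using assms
    by (intro order_trans[OF sum_abs] sum_mono) (auto simp: abs_mult intro: mult_left_mono)
  also have "\<dots> = of_int (norm1 zs) * r"
    unfolding norm1_def by (simp add: sum_list_sum_nth sum_distrib_right lessThan_atLeast0)
  finally show ?thesis .
qed

text \<open>The shape matches the combinations in \<open>newton_row\<close>, which is why
  differences are written there as \<open>1 * a + (-1) * b\<close>.\<close>

lemma dot_map2:
  assumes "length us = length ws"
  shows "dot (map2 (\<lambda>a b. c * a + d * b) us ws) y = of_int c * dot us y + of_int d * dot ws y"
  using assms by (simp add: dot_def sum.distrib sum_distrib_left algebra_simps)

text \<open>With \<open>c = 10000000\<close> this subtracts row \<open>i\<close> of the scaled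
  identity matrix from row \<open>i\<close> of the Jacobian times \<open>A\<close>.\<close>

lemma dot_list_update:
  assumes "i < length zs"
  shows "dot (zs[i := zs ! i - c]) y = dot zs y - of_int c * y i"
proof -
  have "of_int (zs[i := zs ! i - c] ! j) * y j = of_int (zs ! j) * y j - (if j = i then of_int c * y i else 0)"
    if "j < length zs" for j
    using that by (auto simp: algebra_simps)
  then have "dot (zs[i := zs ! i - c]) y = (\<Sum>j<length zs. of_int (zs ! j) * y j - (if j = i then of_int c * y i else 0))"
    unfolding dot_def by (intro sum.cong) auto
  then show ?thesis
    using assms by (simp add: dot_def sum_subtractf)
qed

type_synonym index_point = "nat \<times> nat"

text \<open>
  The unknowns are coordinates \<open>v 1, \<dots>, v m\<close>, with \<open>v 0 = 0\<close>; the point \<open>(k, l)\<close> stands for \<open>(v k, v l)\<close>.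
  The list \<open>X\<close> holds an approximate solution in units of \<open>10^-5\<close>, and the rows of \<open>A\<close> an approximate
  inverse of the Jacobian in units of \<open>10^-2\<close>. The inequality implies that \<open>y \<mapsto> y - f (X + A y)\<close>
  maps the cube of radius \<open>10^-4\<close> into itself, where \<open>f\<close> is half the defect of the squared lengths.
\<close>

definition newton_row :: "int list \<Rightarrow> int list list \<Rightarrow> nat \<Rightarrow> index_point \<times> index_point \<Rightarrow> bool" where
  "newton_row X A i = (\<lambda>((k, l), (k', l')).
     (let dx = X ! k - X ! k'; dy = X ! l - X ! l';
          Dx = map2 (\<lambda>a b. 1 * a + (-1) * b) (A ! k) (A ! k'); Dy = map2 (\<lambda>a b. 1 * a + (-1) * b) (A ! l) (A ! l');
          Z = map2 (\<lambda>a b. dx * a + dy * b) Dx Dy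
      in 10000 * \<bar>dx * dx + dy * dy - 10000000000\<bar> + 2000 * norm1 (Z[i := Z ! i - 10000000]) +
         100 * (norm1 Dx * norm1 Dx + norm1 Dy * norm1 Dy) \<le> 20000000000))"

text \<open>The conditions on index 0 keep the coordinate \<open>v 0\<close> at zero. A row norm of
  2100 in units of 10^-2, applied to a cube of radius 10^-4, moves a coordinate by at most 21/10000,
  that is 0.42 grid units.\<close>

definition newton_check :: "int list \<Rightarrow> int list list \<Rightarrow> (index_point \<times> index_point) list \<Rightarrow> bool" where
  "newton_check X A es \<longleftrightarrow>
     A \<noteq> [] \<and> X ! 0 = 0 \<and> norm1 (A ! 0) = 0 \<and> length X = length A \<and>
     list_all (\<lambda>row. length row = length es \<and> norm1 row \<le> 2100) A \<and>
     list_all (\<lambda>((k, l), (k', l')). k < length A \<and> l < length A \<and> k' < length A \<and> l' < length A) es \<and>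
     list_all (\<lambda>(i, e). newton_row X A i e) (List.enumerate 0 es)"

definition newton_point :: "int list \<Rightarrow> int list list \<Rightarrow> (nat \<Rightarrow> real) \<Rightarrow> nat \<Rightarrow> real" where
  "newton_point X A y k = of_int (X ! k) / 100000 + dot (A ! k) y / 100"

text \<open>The three terms are the residual at the approximate solution, the deviation of the
  linear part from the identity, and the quadratic remainder. The factor 10000000 is the product of
  the units 100000 and 100; halving the defect cancels the 2 from differentiating squares.\<close>

lemma newton_defect:
  fixes x y a b s :: real
  shows "s - ((x / 100000 + a / 100)\<^sup>2 + (y / 100000 + b / 100)\<^sup>2 - 1) / 2 =
     - ((x * x + y * y - 10000000000) / 20000000000) - (x * a + y * b - 10000000 * s) / 10000000 - (a\<^sup>2 + b\<^sup>2) / 20000"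
proof -
  have "(x / 100000 + a / 100)\<^sup>2 = x * x / 10000000000 + x * a / 5000000 + a\<^sup>2 / 10000" for x a :: real
    by (simp add: power2_sum power_divide flip: power2_eq_square)
  then show ?thesis
    by (simp add: add_divide_distrib diff_divide_distrib)
qed

text \<open>The first assumption is the test in \<open>newton_row\<close>: the bounds on the three
  terms of \<open>newton_defect\<close>, multiplied by 2 * 10^14. Here \<open>w\<close> is the norm
  of the linear deviation, and \<open>p\<close>, \<open>q\<close> are the squared norms of
  \<open>Dx\<close>, \<open>Dy\<close>.\<close>

lemma newton_inequality:
  fixes f w p q d s t :: real
  assumes "10000 * \<bar>f\<bar> + 2000 * w + 100 * (p + q) \<le> 20000000000" "\<bar>d\<bar> \<le> w * (1 / 10000)"
    and "0 \<le> s" "0 \<le> t" "s \<le> p / 100000000" "t \<le> q / 100000000"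
  shows "\<bar>- (f / 20000000000) - d / 10000000 - (s + t) / 20000\<bar> \<le> 1 / 10000"
  using assms by argo

lemma newton_row_bound:
  assumes row: "newton_row X A i ((k, l), (k', l'))"
    and len: "length (A ! k) = m" "length (A ! l) = m" "length (A ! k') = m" "length (A ! l') = m"
    and i: "i < m" and y: "\<And>j. j < m \<Longrightarrow> \<bar>y j\<bar> \<le> 1 / 10000"
  shows "\<bar>y i - ((newton_point X A y k - newton_point X A y k')\<^sup>2 +
                (newton_point X A y l - newton_point X A y l')\<^sup>2 - 1) / 2\<bar> \<le> 1 / 10000"
proof -
  define dx dy where "dx = X ! k - X ! k'" and "dy = X ! l - X ! l'"
  define Dx Dy where "Dx = map2 (\<lambda>a b. 1 * a + (-1) * b) (A ! k) (A ! k')"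
    and "Dy = map2 (\<lambda>a b. 1 * a + (-1) * b) (A ! l) (A ! l')"
  define Z where "Z = map2 (\<lambda>a b. dx * a + dy * b) Dx Dy"
  define W where "W = Z[i := Z ! i - 10000000]"
  define F where "F = dx * dx + dy * dy - 10000000000"
  have main: "10000 * \<bar>F\<bar> + 2000 * norm1 W + 100 * (norm1 Dx * norm1 Dx + norm1 Dy * norm1 Dy) \<le> 20000000000"
    using row unfolding newton_row_def F_def W_def Z_def Dx_def Dy_def dx_def dy_def by (simp add: Let_def)
  have lens: "length Dx = m" "length Dy = m" "length Z = m" "length W = m"
    using len by (simp_all add: Dx_def Dy_def Z_def W_def)
  define a b where "a = dot Dx y" and "b = dot Dy y"
  have x: "newton_point X A y k - newton_point X A y k' = of_int dx / 100000 + a / 100"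
    using len unfolding newton_point_def a_def Dx_def by (subst dot_map2) (simp_all add: dx_def add_divide_distrib diff_divide_distrib)
  have y': "newton_point X A y l - newton_point X A y l' = of_int dy / 100000 + b / 100"
    using len unfolding newton_point_def b_def Dy_def by (subst dot_map2) (simp_all add: dy_def add_divide_distrib diff_divide_distrib)
  have W: "dot W y = of_int dx * a + of_int dy * b - 10000000 * y i"
    using lens i unfolding W_def by (subst dot_list_update) (simp_all add: Z_def dot_map2 a_def b_def)
  have bounds: "\<bar>dot W y\<bar> \<le> of_int (norm1 W) * (1 / 10000)" "\<bar>a\<bar> \<le> of_int (norm1 Dx) * (1 / 10000)"
    "\<bar>b\<bar> \<le> of_int (norm1 Dy) * (1 / 10000)"
    using abs_dot_le[of W y "1 / 10000"] abs_dot_le[of Dx y "1 / 10000"] abs_dot_le[of Dy y "1 / 10000"] y lens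
    unfolding a_def b_def by simp_all
  have sq: "a\<^sup>2 \<le> of_int (norm1 Dx * norm1 Dx) / 100000000" "b\<^sup>2 \<le> of_int (norm1 Dy * norm1 Dy) / 100000000"
    using power_mono[OF bounds(2), of 2] power_mono[OF bounds(3), of 2] by (simp_all add: power2_eq_square)
  have eq: "y i - ((newton_point X A y k - newton_point X A y k')\<^sup>2 + (newton_point X A y l - newton_point X A y l')\<^sup>2 - 1) / 2
     = - (of_int F / 20000000000) - dot W y / 10000000 - (a\<^sup>2 + b\<^sup>2) / 20000"
    unfolding x y' W newton_defect by (simp add: F_def)
  have "(10000 * \<bar>of_int F\<bar> + 2000 * of_int (norm1 W) + 100 * (of_int (norm1 Dx * norm1 Dx) + of_int (norm1 Dy * norm1 Dy)) :: real)
     \<le> 20000000000"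
    using main[folded of_int_le_iff[where 'a = real]] by (simp del: of_int_mult)
  then show ?thesis
    unfolding eq using bounds(1) sq by (intro newton_inequality) simp_all
qed

text \<open>There is one variable \<open>y i\<close> per edge, so a fixed point makes the defect of
  every edge vanish.\<close>

lemma newton_solution:
  assumes dim: "DIM('a::euclidean_space) = length es" and check: "newton_check X A es"
  shows "\<exists>v :: nat \<Rightarrow> real. v 0 = 0 \<and> (\<forall>k<length A. \<bar>v k - of_int (X ! k) / 100000\<bar> \<le> 21 / 10000) \<and>
     (\<forall>((k, l), (k', l'))\<in>set es. (v k - v k')\<^sup>2 + (v l - v l')\<^sup>2 = 1)"
proof -
  define m where "m = length es"
  have rows: "length (A ! k) = m" "norm1 (A ! k) \<le> 2100" if "k < length A" for k
    using check that by (auto simp: newton_check_def list_all_length m_def)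
  have checks: "list_all (\<lambda>((k, l), (k', l')). k < length A \<and> l < length A \<and> k' < length A \<and> l' < length A) es"
    "list_all (\<lambda>(i, e). newton_row X A i e) (List.enumerate 0 es)"
    using check unfolding newton_check_def by blast+
  have row: "newton_row X A i (es ! i)" if "i < m" for i
    using checks(2) that by (simp add: list_all_length m_def nth_enumerate_eq)
  have es: "k < length A" "l < length A" "k' < length A" "l' < length A"
    if "((k, l), (k', l')) \<in> set es" for k l k' l'
    using bspec[OF checks(1)[unfolded list_all_iff] that] by simp_all
  define defect where "defect v = (\<lambda>((k, l), (k', l')). (v k - v k')\<^sup>2 + (v l - v l')\<^sup>2 - (1::real))"
    for v :: "nat \<Rightarrow> real"
  define g where "g i y = y i - defect (newton_point X A y) (es ! i) / 2" for i y
  obtain y where y: "\<And>i. i < m \<Longrightarrow> \<bar>y i\<bar> \<le> 1 / 10000" "\<And>i. i < m \<Longrightarrow> g i y = y i"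
  proof -
    have "\<exists>y. (\<forall>i<m. \<bar>y i\<bar> \<le> 1 / 10000 \<and> g i y = y i)"
    proof (rule brouwer_coordinates)
      show "DIM('a) = m"
        using dim by (simp add: m_def)
      show "continuous_on UNIV (\<lambda>x. g i (\<lambda>j. x \<bullet> b j))" for i and b :: "nat \<Rightarrow> 'a"
        unfolding g_def defect_def split_beta newton_point_def dot_def by (intro continuous_intros) simp_all
      show "\<bar>g i y\<bar> \<le> 1 / 10000" if "i < m" "\<And>j. j < m \<Longrightarrow> \<bar>y j\<bar> \<le> 1 / 10000" for i y
      proof -
        obtain k l k' l' where e: "es ! i = ((k, l), (k', l'))"
          by (metis surj_pair)
        then have "((k, l), (k', l')) \<in> set es"
          using that(1) by (metis m_def nth_mem)
        note ix = es[OF this]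
        show ?thesis
          using newton_row_bound[OF row[OF that(1), unfolded e] ix[THEN rows(1)] that]
          unfolding g_def defect_def e split .
      qed
    qed simp
    then show ?thesis using that by blast
  qed
  define v where "v = newton_point X A y"
  have close: "\<bar>v k - of_int (X ! k) / 100000\<bar> \<le> of_int (norm1 (A ! k)) / 1000000" if "k < length A" for k
    using abs_dot_le[of "A ! k" y "1 / 10000"] y(1) rows(1)[OF that] by (simp add: v_def newton_point_def)
  have approx: "\<bar>v k - of_int (X ! k) / 100000\<bar> \<le> 21 / 10000" if "k < length A" for k
  proof -
    have "of_int (norm1 (A ! k)) \<le> (2100 :: real)"
      using rows(2)[OF that] by linarith
    then show ?thesis
      using close[OF that] by linarith
  qed
  have "defect v e = 0" if e: "e \<in> set es" for e
  proof -
    obtain i where i: "i < m" "es ! i = e"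
      using e by (auto simp: in_set_conv_nth m_def)
    show ?thesis
      using y(2)[OF i(1)] unfolding g_def i(2) v_def by simp
  qed
  then have unit: "\<forall>((k, l), (k', l'))\<in>set es. (v k - v k')\<^sup>2 + (v l - v l')\<^sup>2 = 1"
    unfolding defect_def split_beta by simp
  \<comment> \<open>Row 0 of \<open>A\<close> has norm zero, so the error bound \<open>close\<close>
    becomes an equality.\<close>
  have "v 0 = 0"
    using close[of 0] check by (simp add: newton_check_def)
  then show ?thesis
    using approx unit by (intro exI[of _ v] conjI allI impI)
qed

section \<open>Rounding to the nearest integer\<close>

definition nearest :: "int \<Rightarrow> int \<Rightarrow> int" where
  "nearest a b = (2 * a + b) div (2 * b)"

lemma nearest_error:
  assumes "0 < b"
  shows "\<bar>of_int a / of_int b - of_int (nearest a b)\<bar> \<le> (1 / 2 :: real)"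
proof -
  have "of_int (2 * a + b) / of_int (2 * b) = of_int a / of_int b + (1 / 2 :: real)"
    using assms by (simp add: field_simps)
  then have "nearest a b = \<lfloor>of_int a / of_int b + (1 / 2 :: real)\<rfloor>"
    unfolding nearest_def floor_divide_of_int_eq[symmetric, where 'a = real] by simp
  then show ?thesis
    by linarith
qed

subsection \<open>Drawings that are symmetric in both coordinate axes\<close>

text \<open>In \<open>(a, b)\<close> a negative entry stands for the negated coordinate.\<close>

definition signed_point :: "(nat \<Rightarrow> real) \<Rightarrow> int \<times> int \<Rightarrow> complex" where
  "signed_point v = (\<lambda>(a, b). Complex (of_int (sgn a) * v (nat \<bar>a\<bar>)) (of_int (sgn b) * v (nat \<bar>b\<bar>)))"

definition signed_grid :: "int list \<Rightarrow> int \<times> int \<Rightarrow> grid_point" where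
  "signed_grid X = (\<lambda>(a, b). (sgn a * nearest (X ! nat \<bar>a\<bar>) 500, sgn b * nearest (X ! nat \<bar>b\<bar>) 500))"

text \<open>The signs multiply indices, and index 0 is unchanged by them. A vertex on an axis thus
  has the same code as its mirror image, which glues the four copies together.\<close>

definition mirror_images ::
  "(index_point \<times> index_point) list \<Rightarrow> ((int \<times> int) \<times> (int \<times> int)) list" where
  "mirror_images es = concat (map (\<lambda>(s, t). map (\<lambda>((k, l), (k', l')).
     ((s * int k, t * int l), (s * int k', t * int l'))) es) [(1, 1), (1, -1), (-1, 1), (-1, -1)])"

text \<open>For \<open>k = 0\<close> the code has lost the sign \<open>s\<close>, and
  \<open>v 0 = 0\<close> makes both sides vanish.\<close>

lemma signed_coordinate:
  assumes "v 0 = 0" "s \<in> {1, - 1}"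
  shows "of_int (sgn (s * int k)) * v (nat \<bar>s * int k\<bar>) = of_int s * (v k :: real)"
  using assms by (cases "k = 0") (auto simp: sgn_mult)

lemma signed_grid_error:
  assumes "\<bar>x - of_int n / 100000\<bar> \<le> 21 / 10000"
  shows "\<bar>200 * (of_int (sgn a) * x) - of_int (sgn a * nearest n 500)\<bar> \<le> (1 :: real)"
proof -
  have "\<bar>of_int n / 500 - of_int (nearest n 500)\<bar> \<le> (1 / 2 :: real)"
    using nearest_error[of 500 n] by simp
  \<comment> \<open>Converting units of 10^-5 to units of 1/200 divides by 500; the error is at most
    200 * 21/10000 + 1/2 = 0.92.\<close>
  with assms have "\<bar>200 * x - of_int (nearest n 500)\<bar> \<le> 1"
    by argo
  moreover have "\<bar>of_int (sgn a) :: real\<bar> \<le> 1"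
    by (simp add: sgn_if)
  ultimately have "\<bar>of_int (sgn a) :: real\<bar> * \<bar>200 * x - of_int (nearest n 500)\<bar> \<le> 1 * 1"
    by (intro mult_mono) auto
  then show ?thesis
    by (simp flip: abs_mult add: algebra_simps)
qed

lemma mirror_imagesE:
  assumes "e \<in> set (mirror_images es)"
  obtains s t k l k' l' where "s \<in> {1, - 1}" "t \<in> {1, - 1}" "((k, l), (k', l')) \<in> set es"
    "e = ((s * int k, t * int l), (s * int k', t * int l'))"
  using assms by (fastforce simp: mirror_images_def)

text \<open>Reflections preserve squared coordinate differences, so the equations of one quarter
  give all unit lengths. Planarity and degrees are tested on the whole drawing, including where the
  copies meet.\<close>

lemma four_regular_of_quadrant:
  assumes dim: "DIM('a::euclidean_space) = length es" and newton: "newton_check X A es"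
    and card: "length (endpoints (mirror_images es)) = n"
    and check: "drawing_check n (map (map_prod (signed_grid X) (signed_grid X)) (mirror_images es))
      (endpoints (map (map_prod (signed_grid X) (signed_grid X)) (mirror_images es)))"
  shows "\<exists>V E. four_regular_matchstick_graph V E \<and> card V = n"
proof -
  obtain v where v: "v 0 = 0" "\<And>k. k < length A \<Longrightarrow> \<bar>v k - of_int (X ! k) / 100000\<bar> \<le> 21 / 10000"
    and unit: "\<And>k l k' l'. ((k, l), (k', l')) \<in> set es \<Longrightarrow> (v k - v k')\<^sup>2 + (v l - v l')\<^sup>2 = (1::real)"
    using newton_solution[OF dim newton] by fastforce
  have bound: "k < length A" "l < length A" "k' < length A" "l' < length A"
    if "((k, l), (k', l')) \<in> set es" for k l k' l'
  proof -
    have "list_all (\<lambda>((k, l), (k', l')). k < length A \<and> l < length A \<and> k' < length A \<and> l' < length A) es"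
      using newton unfolding newton_check_def by blast
    then show "k < length A" "l < length A" "k' < length A" "l' < length A"
      using that by (auto simp: list_all_iff)
  qed
  show ?thesis
  proof (rule four_regular_of_coded_drawing[OF card check, of "signed_point v"])
    fix c assume "c \<in> set (endpoints (mirror_images es))"
    then obtain e where "e \<in> set (mirror_images es)" "c = fst e \<or> c = snd e"
      by (auto simp: endpoints_def)
    then obtain s t k l k' l' where e: "s \<in> {1, - 1}" "t \<in> {1, - 1}" "((k, l), (k', l')) \<in> set es"
      "c = (s * int k, t * int l) \<or> c = (s * int k', t * int l')"
      by (elim mirror_imagesE) auto
    note bounds = bound[OF e(3)]
    obtain k l where c: "c = (s * int k, t * int l)" "k < length A" "l < length A"
      using e(4) bounds by blast
    have "nat \<bar>s * int k\<bar> = k" "nat \<bar>t * int l\<bar> = l"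
      using e(1,2) by auto
    then show "near_grid (signed_point v c) (signed_grid X c)"
      using signed_grid_error[OF v(2)[OF c(2)], of "s * int k"] signed_grid_error[OF v(2)[OF c(3)], of "t * int l"]
      by (simp add: c(1) near_grid_def signed_point_def signed_grid_def)
  next
    fix c d assume "(c, d) \<in> set (mirror_images es)"
    then obtain s t k l k' l' where cd: "s \<in> {1, - 1}" "t \<in> {1, - 1}" "((k, l), (k', l')) \<in> set es"
      "c = (s * int k, t * int l)" "d = (s * int k', t * int l')"
      by (elim mirror_imagesE) auto
    have "signed_point v c = Complex (of_int s * v k) (of_int t * v l)"
      "signed_point v d = Complex (of_int s * v k') (of_int t * v l')"
      unfolding signed_point_def cd(4,5) using signed_coordinate[of v, OF v(1)] cd(1,2) by simp_all
    then have "dist (signed_point v c) (signed_point v d) =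
        sqrt ((of_int s * (v k - v k'))\<^sup>2 + (of_int t * (v l - v l'))\<^sup>2)"
      by (simp add: dist_norm cmod_def algebra_simps)
    also have "\<dots> = sqrt ((v k - v k')\<^sup>2 + (v l - v l')\<^sup>2)"
      using cd(1,2) by (auto simp: power_mult_distrib)
    finally show "dist (signed_point v c) (signed_point v d) = 1"
      using unit[OF cd(3)] by simp
  qed
qed

subsection \<open>Drawings with coordinates in \<open>\<rat>(\<surd>3, \<surd>5)\<close>\<close>

type_synonym quad = "int \<times> int \<times> int \<times> int"

definition quad_point :: "int \<Rightarrow> quad \<Rightarrow> complex" where
  "quad_point D = (\<lambda>(p, q, r, s). Complex ((of_int p * sqrt 3 + of_int q * sqrt 15) / of_int D)
     ((of_int r + of_int s * sqrt 5) / of_int D))"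

text \<open>The constants are \<open>20000 \<surd>3\<close>, \<open>20000 \<surd>15\<close> and \<open>20000 \<surd>5\<close>, rounded.\<close>

definition quad_grid :: "int \<Rightarrow> quad \<Rightarrow> grid_point" where
  "quad_grid D = (\<lambda>(p, q, r, s).
     (nearest (34641 * p + 77460 * q) (100 * D), nearest (20000 * r + 44721 * s) (100 * D)))"

text \<open>The squared distance times \<open>D\<close> squared has the form a + b
  \<open>sqrt 5\<close>. The first equation fixes its rational part; the second makes half of its
  irrational part vanish.\<close>

definition quad_unit :: "int \<Rightarrow> quad \<times> quad \<Rightarrow> bool" where
  "quad_unit D = (\<lambda>((p, q, r, s), (p', q', r', s')).
     3 * (p - p')\<^sup>2 + 15 * (q - q')\<^sup>2 + (r - r')\<^sup>2 + 5 * (s - s')\<^sup>2 = D\<^sup>2 \<and>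
     3 * (p - p') * (q - q') + (r - r') * (s - s') = 0)"

text \<open>Each rounded constant is off by at most 1/2, so 100 such errors, divided by
  \<open>100 * D\<close>, cost at most half a grid unit.\<close>

definition quad_small :: "quad \<Rightarrow> bool" where
  "quad_small = (\<lambda>(p, q, r, s). \<bar>p\<bar> + \<bar>q\<bar> + \<bar>r\<bar> + \<bar>s\<bar> \<le> 100)"

text \<open>Rotation by \<open>60\<close> degrees; the halves are exact for the orbits of the points used below.\<close>

definition quad_rotate :: "quad \<Rightarrow> quad" where
  "quad_rotate = (\<lambda>(p, q, r, s). ((p - r) div 2, (q - s) div 2, (3 * p + r) div 2, (3 * q + s) div 2))"

definition images :: "('a \<Rightarrow> 'a) list \<Rightarrow> ('a \<times> 'a) list \<Rightarrow> ('a \<times> 'a) list" where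
  "images fs es = concat (map (\<lambda>f. map (map_prod f f) es) fs)"

lemma sqrt_bounds:
  "\<bar>20000 * sqrt 3 - 34641\<bar> \<le> 1 / 2" "\<bar>20000 * sqrt 15 - 77460\<bar> \<le> 1 / 2" "\<bar>20000 * sqrt 5 - 44721\<bar> \<le> 1 / 2"
proof -
  \<comment> \<open>Squaring reduces each bound to rational arithmetic.\<close>
  have *: "\<bar>20000 * sqrt a - b\<bar> \<le> 1 / 2"
    if "(b - 1 / 2)\<^sup>2 \<le> 400000000 * a" "400000000 * a \<le> (b + 1 / 2)\<^sup>2" "1 / 2 \<le> b" for a b :: real
  proof -
    have "20000 * sqrt a = sqrt (400000000 * a)"
      by (simp add: real_sqrt_mult)
    moreover have "b - 1 / 2 \<le> sqrt (400000000 * a)" "sqrt (400000000 * a) \<le> b + 1 / 2"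
      using that by (auto intro: real_le_rsqrt real_le_lsqrt)
    ultimately show ?thesis
      by linarith
  qed
  show "\<bar>20000 * sqrt 3 - 34641\<bar> \<le> 1 / 2" "\<bar>20000 * sqrt 15 - 77460\<bar> \<le> 1 / 2" "\<bar>20000 * sqrt 5 - 44721\<bar> \<le> 1 / 2"
    by (intro *; simp add: power2_eq_square)+
qed

text \<open>One half comes from the rounded constants, the other from \<open>nearest\<close>. Both
  coordinates are covered: \<open>x\<close>, \<open>y\<close> are \<open>sqrt 3\<close>,
  \<open>sqrt 15\<close> for the real part and 1, \<open>sqrt 5\<close> for the imaginary
  part.\<close>

lemma quad_grid_error:
  fixes p q :: int and x y x' y' :: real
  assumes "0 < D" "\<bar>p\<bar> + \<bar>q\<bar> \<le> 100" "\<bar>20000 * x - of_int m\<bar> \<le> 1 / 2" "\<bar>20000 * y - of_int n\<bar> \<le> 1 / 2"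
  shows "\<bar>200 * ((of_int p * x + of_int q * y) / of_int D) - of_int (nearest (m * p + n * q) (100 * D))\<bar> \<le> 1"
proof -
  let ?t = "of_int (m * p + n * q) / of_int (100 * D) :: real"
  have "\<bar>of_int p * (20000 * x - of_int m)\<bar> \<le> \<bar>of_int p\<bar> * (1 / 2)"
    "\<bar>of_int q * (20000 * y - of_int n)\<bar> \<le> \<bar>of_int q\<bar> * (1 / 2)"
    unfolding abs_mult using assms by (intro mult_left_mono; simp)+
  moreover have "\<bar>of_int p\<bar> + \<bar>of_int q\<bar> \<le> (100 :: real)"
    using assms(2) by linarith
  ultimately have "\<bar>of_int p * (20000 * x - of_int m) + of_int q * (20000 * y - of_int n)\<bar> \<le> 50"
    by linarith
  then have "\<bar>of_int p * (20000 * x - of_int m) + of_int q * (20000 * y - of_int n)\<bar> / (100 * of_int D) \<le> 50 / (100 * 1)"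
    using assms(1) by (intro frac_le) auto
  moreover have "200 * ((of_int p * x + of_int q * y) / of_int D) - ?t =
      (of_int p * (20000 * x - of_int m) + of_int q * (20000 * y - of_int n)) / (100 * of_int D)"
    using assms(1) by (simp add: field_simps)
  ultimately have "\<bar>200 * ((of_int p * x + of_int q * y) / of_int D) - ?t\<bar> \<le> 1 / 2"
    using assms(1) by (simp add: abs_divide abs_mult)
  moreover have "\<bar>?t - of_int (nearest (m * p + n * q) (100 * D))\<bar> \<le> 1 / 2"
    using assms(1) by (intro nearest_error) simp
  ultimately show ?thesis
    by linarith
qed

lemma near_quad_grid:
  assumes "0 < D" "quad_small c"
  shows "near_grid (quad_point D c) (quad_grid D c)"
proof -
  obtain p q r s where c: "c = (p, q, r, s)"
    by (metis surj_pair)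
  have "\<bar>p\<bar> + \<bar>q\<bar> \<le> 100" "\<bar>r\<bar> + \<bar>s\<bar> \<le> 100"
    using assms(2) by (auto simp: quad_small_def c)
  then show ?thesis
    using quad_grid_error[OF assms(1), of p q "sqrt 3" 34641 "sqrt 15" 77460]
      quad_grid_error[OF assms(1), of r s 1 20000 "sqrt 5" 44721] sqrt_bounds
    by (simp add: near_grid_def quad_point_def quad_grid_def c)
qed

lemma quad_unit_dist:
  assumes "0 < D" "quad_unit D (c, d)"
  shows "dist (quad_point D c) (quad_point D d) = 1"
proof -
  obtain p q r s where c: "c = (p, q, r, s)"
    by (metis surj_pair)
  obtain p' q' r' s' where d: "d = (p', q', r', s')"
    by (metis surj_pair)
  define P Q R S where "P = p - p'" and "Q = q - q'" and "R = r - r'" and "S = s - s'"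
  have "3 * P\<^sup>2 + 15 * Q\<^sup>2 + R\<^sup>2 + 5 * S\<^sup>2 = D\<^sup>2" "3 * P * Q + R * S = 0"
    using assms(2) by (simp_all add: quad_unit_def c d P_def Q_def R_def S_def)
  then have int: "3 * (of_int P)\<^sup>2 + 15 * (of_int Q)\<^sup>2 + (of_int R)\<^sup>2 + 5 * (of_int S)\<^sup>2 = (of_int D :: real)\<^sup>2"
    "3 * of_int P * of_int Q + of_int R * of_int S = (0 :: real)"
    by (metis (mono_tags) of_int_add of_int_mult of_int_numeral of_int_power,
        metis (mono_tags) of_int_add of_int_mult of_int_numeral of_int_0)
  have s15: "sqrt 15 = sqrt 3 * sqrt 5"
    by (simp flip: real_sqrt_mult)
  have "(of_int P * sqrt 3 + of_int Q * sqrt 15)\<^sup>2 + (of_int R + of_int S * sqrt 5)\<^sup>2 =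
      3 * (of_int P)\<^sup>2 + 15 * (of_int Q)\<^sup>2 + (of_int R)\<^sup>2 + 5 * (of_int S)\<^sup>2
      + 2 * sqrt 5 * (3 * of_int P * of_int Q + of_int R * of_int S)"
    by (simp add: power2_sum power_mult_distrib s15 algebra_simps)
  also have "\<dots> = (of_int D)\<^sup>2"
    using int by simp
  finally have "((of_int P * sqrt 3 + of_int Q * sqrt 15) / of_int D)\<^sup>2 + ((of_int R + of_int S * sqrt 5) / of_int D)\<^sup>2 = 1"
    using assms(1) by (simp add: power_divide flip: add_divide_distrib)
  moreover have "quad_point D c - quad_point D d =
      Complex ((of_int P * sqrt 3 + of_int Q * sqrt 15) / of_int D) ((of_int R + of_int S * sqrt 5) / of_int D)"
    by (simp add: quad_point_def c d P_def Q_def R_def S_def complex_eq_iff diff_divide_distrib add_divide_distrib algebra_simps)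
  ultimately show ?thesis
    by (simp add: dist_norm cmod_def)
qed

lemma four_regular_of_quads:
  assumes "0 < D" and unit: "list_all (quad_unit D) es" and small: "list_all quad_small (endpoints es)"
    and card: "length (endpoints es) = n"
    and check: "drawing_check n (map (map_prod (quad_grid D) (quad_grid D)) es)
      (endpoints (map (map_prod (quad_grid D) (quad_grid D)) es))"
  shows "\<exists>V E. four_regular_matchstick_graph V E \<and> card V = n"
  using four_regular_of_coded_drawing[OF card check, of "quad_point D"] unit small
    near_quad_grid[OF assms(1)] quad_unit_dist[OF assms(1)]
  by (auto simp: list_all_iff)

subsection \<open>The four graphs\<close>

text \<open>One quarter of the graph; index 0 marks the vertices on the axes. The four images have 4
  * 26 = 104 edges, as 52 vertices of degree 4 demand.\<close>

definition edges52 :: "(index_point \<times> index_point) list" where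
  "edges52 =
    [((1, 0), (5, 6)), ((5, 6), (0, 3)), ((2, 0), (7, 8)), ((7, 8), (1, 0)), ((0, 3), (9, 10)),
     ((9, 10), (11, 12)), ((11, 12), (0, 4)), ((5, 6), (9, 10)), ((7, 8), (13, 14)),
     ((13, 14), (15, 16)), ((15, 16), (5, 6)), ((15, 16), (17, 18)), ((17, 18), (19, 20)),
     ((19, 20), (9, 10)), ((19, 20), (11, 12)), ((17, 18), (21, 22)), ((21, 22), (19, 20)),
     ((21, 22), (11, 12)), ((21, 22), (0, 4)), ((15, 16), (23, 24)), ((13, 14), (23, 24)),
     ((23, 24), (17, 18)), ((13, 14), (25, 26)), ((7, 8), (25, 26)), ((25, 26), (23, 24)),
     ((2, 0), (25, 26))]"

definition coords52 :: "int list" where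
  "coords52 =
    [0, 99505, 298042, 63993, 362144, 93365, 99811, 198774, 12073, 15663, 162759, 7831, 262452,
     159594, 104078, 120415, 196083, 180505, 276016, 98084, 219387, 90252, 319080, 219684, 184011,
     258863, 92005]"

text \<open>Two decimals suffice because \<open>newton_row\<close> only needs the Jacobian times
  this matrix to differ from the identity by less than 1 in each absolute row sum, with room for the
  other two terms.\<close>

definition inverse52 :: "int list list" where
  "inverse52 =
    [[0, 0, 0, 0, 0, 0, 0, 0, 0, 0, 0, 0, 0, 0, 0, 0, 0, 0, 0, 0, 0, 0, 0, 0, 0, 0], [-189, -15,
     -91, -112, 5, -56, -56, -55, 2, 36, -165, -153, 47, 47, 0, 130, 0, 0, 130, 33, -33, 164, 33,
     -33, 198, 231], [-206, -19, 13, -13, 7, -58, -58, -57, 23, 50, -183, -159, 50, 50, 0, 134, 0,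
     0, 134, 27, -27, 170, 27, -27, 197, 223], [96, -23, -2, 6, -93, -18, -18, 54, -7, -15, 55, 48,
     -70, -70, 0, 41, 0, 0, 41, -8, 8, 21, -8, 8, 13, 4], [100, -38, 0, 6, 14, 88, 88, 69, -5, -12,
     44, 39, -54, -54, 0, 29, 0, 0, 29, -7, 7, 13, -7, 7, 6, 0], [-6, 96, -3, 0, -35, -8, -8, 19,
     -2, -5, 17, 15, -25, -25, 0, 18, 0, 0, 18, -2, 2, 12, -2, 2, 9, 7], [111, 7, 5, 7, -2, 3, 3, 5,
     0, -2, 11, 10, -4, -4, 0, -7, 0, 0, -7, -2, 2, -9, -2, 2, -12, -14], [-197, -17, -90, -12, 6,
     -57, -57, -56, 13, 43, -174, -156, 49, 49, 0, 132, 0, 0, 132, 30, -30, 167, 30, -30, 197, 227],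
     [71, 17, -13, 4, -6, 7, 7, 11, -86, -58, 73, 25, -11, -11, 0, -17, 0, 0, -17, 28, -28, -23, 28,
     -28, 5, 32], [-17, 64, -8, -1, -23, -22, -22, -61, -7, -13, 47, 40, -70, -70, 0, 51, 0, 0, 51,
     -6, 6, 32, -6, 6, 26, 19], [98, -33, 0, 6, 12, -14, -14, 64, -6, -13, 48, 42, -59, -59, 0, 33,
     0, 0, 33, -7, 7, 16, -7, 7, 8, 1], [-8, 32, -4, -1, -12, -44, -36, -31, -3, -7, 23, 20, -35,
     23, -58, 25, 58, -58, 83, -3, 3, 16, -3, 3, 13, 10], [99, -35, 0, 6, 13, 84, -15, 66, -5, -12,
     46, 40, -57, -52, -5, 31, 5, -5, 36, -7, 7, 14, -7, 7, 7, 0], [-131, -1, -60, -8, 0, -50, -50,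
     -46, -53, -11, -106, -133, 38, 38, 0, 116, 0, 0, 116, 56, -56, 146, -51, 51, 202, 151], [100,
     23, 0, 6, -8, 10, 10, 15, -5, -81, 102, 35, -15, -15, 0, -23, 0, 0, -23, 39, -39, -32, -7, 7,
     6, 0], [-65, 14, -29, -4, -5, -44, -44, -35, -26, -51, -39, -109, 28, 28, 0, 101, 0, 0, 101,
     -25, 25, 125, -25, 25, 100, 75], [128, 30, 13, 8, -11, 13, 13, 20, 6, 11, 131, 45, -20, -20, 0,
     -30, 0, 0, -30, 4, -4, -41, 4, -4, -37, -33], [-7, 27, -3, 0, -10, -38, -38, -27, -3, -6, 20,
     17, 20, 20, 0, 87, 0, 0, 87, -3, 3, 14, -3, 3, 11, 8], [85, 20, -7, 5, -7, 9, 9, 13, -11, -24,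
     86, 75, -13, -13, 0, -20, 0, 0, -20, -13, 13, 42, -13, 13, 30, 17], [-12, 46, -5, -1, -17, -63,
     -30, -44, -5, -9, 33, 29, -50, 32, 33, 36, 33, -33, 69, -5, 5, 23, -5, 5, 18, 14], [92, -7, -4,
     6, 2, 45, -3, 39, -8, -18, 67, 58, -88, -32, -48, 54, -48, 48, 7, -10, 10, 29, -10, 10, 19, 9],
     [-4, 14, -2, 0, -5, -19, -44, -13, -1, -3, 10, 9, -15, 10, -25, 11, 25, 25, 101, -1, 1, 7, -1,
     1, 6, 4], [92, -9, -3, 6, 3, 48, -4, 41, -8, -18, 65, 57, -86, -33, -52, 52, 52, 52, 9, -10,
     10, 28, -10, 10, 18, 8], [-73, 12, -33, -5, -4, -44, -44, -37, -30, -58, -48, -112, 30, 30, 0,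
     103, 0, 0, 103, 78, 28, 127, -28, 28, 113, 85], [56, 13, -20, 3, -5, 6, 6, 9, -22, -46, 58, 20,
     -9, -9, 0, -13, 0, 0, -13, 22, 23, -18, -23, 23, 73, 50], [-140, -3, -64, -9, 1, -51, -51, -47,
     -56, -4, -115, -136, 40, 40, 0, 118, 0, 0, 118, 52, -52, 149, 52, 54, 201, 161], [28, 7, -32,
     2, -2, 3, 3, 4, -34, -23, 29, 10, -4, -4, 0, -7, 0, 0, -7, 11, -11, -9, 11, 34, 2, 82]]"

definition edges54 :: "(index_point \<times> index_point) list" where
  "edges54 =
    [((1, 0), (0, 3)), ((2, 0), (6, 7)), ((6, 7), (8, 9)), ((8, 9), (1, 0)), ((0, 4), (10, 11)),
     ((10, 11), (0, 5)), ((0, 3), (12, 13)), ((12, 13), (0, 4)), ((8, 9), (12, 13)),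
     ((12, 13), (14, 15)), ((14, 15), (16, 17)), ((16, 17), (10, 11)), ((8, 9), (18, 19)),
     ((18, 19), (20, 21)), ((20, 21), (14, 15)), ((6, 7), (18, 19)), ((2, 0), (22, 23)),
     ((22, 23), (6, 7)), ((22, 23), (18, 19)), ((22, 23), (20, 21)), ((10, 11), (24, 25)),
     ((16, 17), (24, 25)), ((24, 25), (0, 5)), ((16, 17), (26, 27)), ((14, 15), (26, 27)),
     ((26, 27), (24, 25)), ((20, 21), (26, 27))]"

definition coords54 :: "int list" where
  "coords54 =
    [0, 64973, 363820, 76017, 100781, 299566, 264012, 6191, 164203, 12382, 11003, 200173, 99230,
     88399, 194160, 119838, 102581, 160006, 219469, 95723, 274735, 179064, 319277, 89532, 91578,
     259399, 183156, 219231]"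

definition inverse54 :: "int list list" where
  "inverse54 =
    [[0, 0, 0, 0, 0, 0, 0, 0, 0, 0, 0, 0, 0, 0, 0, 0, 0, 0, 0, 0, 0, 0, 0, 0, 0, 0, 0], [-9, -10,
     -10, -106, 23, 13, -53, 185, 75, 87, -19, -6, -85, -85, 80, 0, 23, 0, 0, 23, 12, -12, -32, 12,
     -12, -20, -8], [-16, 97, 97, -10, 31, 20, -97, 249, 95, 94, -20, -6, -81, -81, 86, 0, 8, 0, 0,
     8, 14, -14, -50, 14, -14, -37, -23], [139, 9, 9, 91, -20, -11, 45, -158, -64, -74, 16, 6, 72,
     72, -68, 0, -19, 0, 0, -19, -11, 11, 28, -11, 11, 17, 7], [-22, -61, -61, -14, -105, -89, -135,
     -33, -44, -146, 26, 0, 33, 33, -139, 0, 137, 0, 0, 137, -26, 26, 221, -26, 26, 195, 169], [-25,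
     -62, -62, -17, -3, 16, -156, -22, -43, -157, 37, 18, 32, 32, -140, 0, 140, 0, 0, 140, -19, 19,
     210, -19, 19, 191, 172], [-15, -6, 93, -10, 30, 19, -90, 238, 92, 93, -20, -6, -78, -82, 85,
     -4, 14, -4, 4, 11, 14, -14, -47, 14, -14, -34, -20], [19, -43, -49, 13, -21, -20, 118, -170,
     -54, -18, 2, -1, 48, -10, -18, -58, 97, -58, 58, 39, -4, 4, 48, -4, 4, 44, 40], [-13, -6, -6,
     -9, 28, 18, -82, 228, 88, 92, -19, -6, -82, -82, 84, 0, 13, 0, 0, 13, 13, -13, -45, 13, -13,
     -31, -18], [38, -35, -35, 25, -42, -39, 236, -341, -109, -36, 5, -3, -20, -20, -35, 0, 78, 0,
     0, 78, -8, 8, 97, -8, 8, 89, 81], [15, 7, 7, 10, -6, -20, 95, -47, -2, 51, -51, -84, 4, 4, 7,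
     0, -15, 0, 0, -15, -33, 33, 50, -33, 33, 17, -15], [-24, -62, -62, -16, -3, -87, -146, -27,
     -43, -151, 31, 9, 33, 33, -139, 0, 138, 0, 0, 138, -23, 23, 215, -23, 23, 193, 170], [10, 4, 4,
     7, 5, 5, 62, 43, -1, 4, -1, 0, 2, 2, 4, 0, -10, 0, 0, -10, 1, -1, -12, 1, -1, -11, -10], [58,
     -26, -26, 38, -62, -50, 359, -499, -54, -110, 21, 3, 53, 53, -103, 0, 59, 0, 0, 59, -18, 18,
     124, -18, 18, 106, 88], [28, 12, 12, 18, -11, 1, 171, -85, -4, 92, 23, 10, 7, 7, 12, 0, -27, 0,
     0, -27, -13, 13, -3, -13, 13, -15, -28], [5, -49, -49, 3, -14, -39, 29, -114, -47, -57, -50,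
     -27, 40, 40, -127, 0, 111, 0, 0, 111, 23, -23, 96, 23, -23, 119, 142], [22, 9, 9, 14, -8, -10,
     133, -66, -3, 72, -71, -3, 5, 5, 9, 0, -21, 0, 0, -21, 0, 0, 24, -46, 46, 24, -22], [-10, -56,
     -56, -6, -9, -63, -59, -71, -45, -104, -15, -55, 36, 36, -133, 0, 124, 0, 0, 124, 53, -53, 155,
     -53, 53, 209, 156], [3, 1, 49, 2, 11, 2, 16, 85, 43, 77, -17, -7, -35, -91, 69, -48, -3, 48,
     -48, 46, 10, -10, -4, 10, -10, 6, 16], [28, -39, -71, 18, -31, -28, 171, -247, -79, -26, 4, -2,
     69, -14, -26, 32, 88, -32, 32, 56, -6, 6, 70, -6, 6, 64, 59], [19, 8, 8, 12, -7, -15, 115, -57,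
     -2, 62, -15, -9, 5, 5, 55, 0, -18, 0, 0, -18, 7, -7, 36, 7, -7, 43, 50], [17, -44, -44, 11,
     -19, -17, 105, -152, -48, -16, 2, -1, 43, 43, -16, 0, 99, 0, 0, 99, -3, 3, 43, -3, 3, 40, 36],
     [1, 1, 52, 1, 12, 3, 9, 96, 46, 78, -18, -7, -38, -90, 70, -52, -1, 52, 52, 43, 10, -10, -7,
     10, -10, 3, 13], [9, -48, -22, 6, -9, -9, 53, -76, -24, -8, 1, -1, 21, -4, -8, -26, 107, 26,
     26, 17, -2, 2, 22, -2, 2, 20, 18], [6, 3, 3, 4, -2, -36, 38, -19, -1, 21, -21, -34, 2, 2, 3, 0,
     -6, 0, 0, -6, 33, 13, 89, -13, 13, 7, -6], [-11, -56, -56, -7, -8, -66, -69, -66, -45, -110,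
     -10, -59, 36, 36, -134, 0, 126, 0, 0, 126, 57, 49, 163, -49, 49, 207, 158], [12, 5, 5, 8, -5,
     -25, 76, -38, -2, 41, -41, -21, 3, 3, 5, 0, -12, 0, 0, -12, 20, -20, 62, 20, 26, 82, -13], [3,
     -50, -50, 2, -14, -42, 18, -109, -47, -63, -57, -30, 39, 39, -128, 0, 112, 0, 0, 112, 27, -27,
     103, 27, 79, 129, 143]]"

text \<open>One third of the graph, with common denominator 24: 3 * 38 = 2 * 57 edges.\<close>

definition edges57 :: "(quad \<times> quad) list" where
  "edges57 =
    [((-20, -12, 0, 0), (-20, -12, -24, 0)), ((-20, -12, 24, 0), (-20, -12, 0, 0)),
     ((-20, -12, 24, 0), (-8, -12, 12, 0)), ((-20, -6, -18, 0), (-20, -12, -24, 0)),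
     ((-20, -6, 18, 0), (-20, -12, 24, 0)), ((-17, -9, -21, -9), (-20, -12, -24, 0)),
     ((-17, -9, -21, -9), (-20, -6, -18, 0)), ((-17, -9, 21, 9), (-20, -12, 24, 0)),
     ((-17, -9, 21, 9), (-20, -6, 18, 0)), ((-17, -3, -15, -9), (-20, -6, -18, 0)),
     ((-17, -3, -15, -9), (-17, -9, -21, -9)), ((-17, -3, 15, 9), (-20, -6, 18, 0)),
     ((-17, -3, 15, 9), (-17, -9, 21, 9)), ((-14, -6, -18, -18), (-17, -9, -21, -9)),
     ((-14, -6, -18, -18), (-17, -3, -15, -9)), ((-14, -6, 18, 18), (-17, -9, 21, 9)),
     ((-14, -6, 18, 18), (-17, -3, 15, 9)), ((-14, -6, 18, 18), (-2, -6, 30, 18)),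
     ((-8, -12, -12, 0), (-20, -12, -24, 0)), ((-8, -12, -12, 0), (-20, -12, 0, 0)),
     ((-8, -12, -12, 0), (-8, -6, -6, 0)), ((-8, -12, 12, 0), (-20, -12, 0, 0)),
     ((-8, -12, 12, 0), (-8, -12, -12, 0)), ((-8, -6, -6, 0), (-20, -6, -18, 0)),
     ((-8, -6, 6, 0), (-20, -6, 18, 0)), ((-8, -6, 6, 0), (-8, -12, 12, 0)),
     ((-8, 0, 0, 0), (-8, -6, -6, 0)), ((-8, 0, 0, 0), (-8, -6, 6, 0)),
     ((-8, 0, 0, 0), (-5, -3, -3, -9)), ((-5, -3, -3, -9), (-17, -3, -15, -9)),
     ((-5, -3, -3, -9), (-8, -6, -6, 0)), ((-5, -3, 3, 9), (-17, -3, 15, 9)),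
     ((-5, -3, 3, 9), (-8, -6, 6, 0)), ((-5, -3, 3, 9), (-8, 0, 0, 0)),
     ((-2, -6, -6, -18), (-14, -6, -18, -18)), ((-2, -6, -6, -18), (-5, -3, -3, -9)),
     ((-2, -6, -6, -18), (-2, -6, -30, -18)), ((-2, -6, -6, -18), (1, -3, -9, -9))]"

text \<open>One sixth of the graph, with common denominator 8: 6 * 20 = 2 * 60 edges.\<close>

definition edges60 :: "(quad \<times> quad) list" where
  "edges60 =
    [((1, 1, -7, -3), (5, 1, -3, -3)), ((5, 1, -3, -3), (4, 2, -2, 0)),
     ((2, 2, -14, -6), (2, 2, -6, -6)), ((2, 2, -6, -6), (1, 1, -7, -3)),
     ((4, 2, -2, 0), (8, 2, -6, 0)), ((8, 2, -6, 0), (8, 4, -4, 0)),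
     ((5, 1, -3, -3), (9, 1, -7, -3)), ((9, 1, -7, -3), (8, 2, -6, 0)),
     ((2, 2, -6, -6), (6, 2, -2, -6)), ((6, 2, -2, -6), (5, 1, -3, -3)),
     ((6, 2, -2, -6), (10, 2, -6, -6)), ((10, 2, -6, -6), (9, 1, -7, -3)),
     ((6, 2, -2, -6), (6, 2, -10, -6)), ((2, 2, -6, -6), (6, 2, -10, -6)),
     ((6, 2, -10, -6), (10, 2, -6, -6)), ((2, 2, -14, -6), (6, 2, -10, -6)),
     ((8, 2, -6, 0), (9, 3, -5, -3)), ((9, 1, -7, -3), (9, 3, -5, -3)),
     ((9, 3, -5, -3), (8, 4, -4, 0)), ((10, 2, -6, -6), (9, 3, -5, -3))]"

section \<open>Evaluation of the certificates\<close>

lemma graph52: "\<exists>V E. four_regular_matchstick_graph V E \<and> card V = 52"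
proof (rule four_regular_of_quadrant)
  \<comment> \<open>This fixes the space for Brouwer's theorem: one dimension per edge of the
    quarter.\<close>
  show "DIM(real ^ 26) = length edges52"
    by (simp add: edges52_def)
  show "newton_check coords52 inverse52 edges52"
    by code_simp
  show "length (endpoints (mirror_images edges52)) = 52"
    by code_simp
  show "drawing_check 52 (map (map_prod (signed_grid coords52) (signed_grid coords52)) (mirror_images edges52))
      (endpoints (map (map_prod (signed_grid coords52) (signed_grid coords52)) (mirror_images edges52)))"
    by code_simp
qed

lemma graph54: "\<exists>V E. four_regular_matchstick_graph V E \<and> card V = 54"
proof (rule four_regular_of_quadrant)
  show "DIM(real ^ 27) = length edges54"
    by (simp add: edges54_def)
  show "newton_check coords54 inverse54 edges54"
    by code_simp
  show "length (endpoints (mirror_images edges54)) = 54"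
    by code_simp
  show "drawing_check 54 (map (map_prod (signed_grid coords54) (signed_grid coords54)) (mirror_images edges54))
      (endpoints (map (map_prod (signed_grid coords54) (signed_grid coords54)) (mirror_images edges54)))"
    by code_simp
qed

lemma graph57: "\<exists>V E. four_regular_matchstick_graph V E \<and> card V = 57"
proof (rule four_regular_of_quads)
  show "(0 :: int) < 24"
    by simp
  \<comment> \<open>Lengths are tested after rotation, on every copy; the powers 0, 2 and 4 are the
    rotations by 0, 120 and 240 degrees.\<close>
  show "list_all (quad_unit 24) (images [id, quad_rotate ^^ 2, quad_rotate ^^ 4] edges57)"
    by code_simp
  show "list_all quad_small (endpoints (images [id, quad_rotate ^^ 2, quad_rotate ^^ 4] edges57))"
    by code_simp
  show "length (endpoints (images [id, quad_rotate ^^ 2, quad_rotate ^^ 4] edges57)) = 57"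
    by code_simp
  show "drawing_check 57 (map (map_prod (quad_grid 24) (quad_grid 24)) (images [id, quad_rotate ^^ 2, quad_rotate ^^ 4] edges57))
      (endpoints (map (map_prod (quad_grid 24) (quad_grid 24)) (images [id, quad_rotate ^^ 2, quad_rotate ^^ 4] edges57)))"
    by code_simp
qed

lemma graph60: "\<exists>V E. four_regular_matchstick_graph V E \<and> card V = 60"
proof (rule four_regular_of_quads)
  show "(0 :: int) < 8"
    by simp
  show "list_all (quad_unit 8) (images (map (\<lambda>i. quad_rotate ^^ i) [0, 1, 2, 3, 4, 5]) edges60)"
    by code_simp
  show "list_all quad_small (endpoints (images (map (\<lambda>i. quad_rotate ^^ i) [0, 1, 2, 3, 4, 5]) edges60))"
    by code_simp
  show "length (endpoints (images (map (\<lambda>i. quad_rotate ^^ i) [0, 1, 2, 3, 4, 5]) edges60)) = 60"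
    by code_simp
  show "drawing_check 60 (map (map_prod (quad_grid 8) (quad_grid 8)) (images (map (\<lambda>i. quad_rotate ^^ i) [0, 1, 2, 3, 4, 5]) edges60))
      (endpoints (map (map_prod (quad_grid 8) (quad_grid 8)) (images (map (\<lambda>i. quad_rotate ^^ i) [0, 1, 2, 3, 4, 5]) edges60)))"
    by code_simp
qed

theorem theorem2:
  fixes n :: nat
  assumes "n \<in> {52, 54, 57, 60}"
  shows "\<exists>V E. four_regular_matchstick_graph V E \<and> card V = n"
  using assms graph52 graph54 graph57 graph60 by auto

end
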